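(* Let $k\in\mathbb Z_{>0}$ and let $Q=(Q_0,Q_1)$ be a quiver weighted by $b:Q_1\to B$, with $n=\#Q_0$. Then $$\mathrm{Tr}_{M_n(B)}\big([\mathscr A_Q^{\mathrm{sym}}(b)]^k\big)=\sum_{\substack{p\in\Omega Q^\star\\ \ell(p)=k}}\mathcal W^{\mathrm{sym}}(p),$$ where $\mathcal W^{\mathrm{sym}}(p)=\mathrm{Tr}_B\big(b^{\mathrm{sym}}_{e_1}b^{\mathrm{sym}}_{e_2}\cdots b^{\mathrm{sym}}_{e_k}\big)$ for $p=[e_1,\dots,e_k]$. Moreover, if $\bar p$ denotes the loop $p\in\Omega_v(Q^\star)$ run backwards, then $\mathcal W^{\mathrm{sym}}(\bar p)=\overline{\mathcal W^{\mathrm{sym}}(p)}$ (complex conjugate), so $\mathrm{Tr}_{M_n(B)}\big([\mathscr A_Q^{\mathrm{sym}}(b)]^k\big)$ is real-valued.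
   Context: A quiver $Q=(Q_0,Q_1)$ is a directed multigraph (self-loops allowed) with finite vertex set $Q_0$, finite edge set $Q_1$, source and target maps $s,t$. $B$ is a finite-dimensional unital complex $*$-algebra with a trace $\mathrm{Tr}_B:B\to\mathbb C$, i.e. a linear functional with $\mathrm{Tr}_B(xy)=\mathrm{Tr}_B(yx)$ and $\mathrm{Tr}_B(x^* )=\overline{\mathrm{Tr}_B(x)}$; $\mathrm{Tr}_{M_n(B)}(W)=\sum_{i=1}^n\mathrm{Tr}_B(W_{i,i})$. The symmetrised weight matrix $\mathscr A_Q^{\mathrm{sym}}(b)\in M_{\#Q_0}(B)$ has entries $$[\mathscr A^{\mathrm{sym}}_Q(b)]_{i,j}=\sum_{e:\,s(e)=i,\,t(e)=j}b_e+\sum_{e:\,s(e)=j,\,t(e)=i}b_e^*.$$ The augmented quiver $Q^\star=(Q_0,Q_1\cup\bar Q_1)$ has, for each $e\in Q_1$ that is not a self-loop, an additional edge $\bar e$ with $s(\bar e)=t(e)$ and $t(\bar e)=s(e)$; self-loops cause no additional edges. The symmetrised weights on $Q^\star$ are $b^{\mathrm{sym}}_e=b_e$ and $b^{\mathrm{sym}}_{\bar e}=b_e^*$ for $e\in Q_1$ not a self-loop, and $b_e^{\mathrm{sym}}=b_e+b_e^*$ for a self-loop $e$. A path $[e_1,\dots,e_k]$ of length $\ell=k$ satisfies $t(e_a)=s(e_{a+1})$. $\Omega_vQ^\star$ is the set of closed paths of positive length in $Q^\star$ starting and ending at $v$, and $\Omega Q^\star=\bigcup_v\Omega_vQ^\star$.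 The reverse $\bar p$ of $p=[e_1,\dots,e_k]$ is $[\bar e_k,\dots,\bar e_1]$, with $\bar{\bar e}=e$ and $\bar e=e$ for self-loops. *)

theory Defs
  imports Complex_Main "Jordan_Normal_Form.Matrix" "Graph_Theory.Digraph" "Graph_Theory.Arc_Walk"
begin

text \<open>
  The sort \<open>{ring, monoid_mult}\<close> is a unital ring in which \<open>0 = 1\<close> is not excluded,
  so that the zero algebra is covered (unlike with \<open>ring_1\<close>).
\<close>

locale fin_dim_star_algebra = vector_space scale
  for scale :: "complex \<Rightarrow> 'b::{ring, monoid_mult} \<Rightarrow> 'b" +
  fixes star :: "'b \<Rightarrow> 'b"
  assumes scale_mult_left: "scale c x * y = scale c (x * y)"
    and scale_mult_right: "x * scale c y = scale c (x * y)"
    and star_add: "star (x + y) = star x + star y"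
    and star_scale: "star (scale c x) = scale (cnj c) (star x)"
    and star_mult: "star (x * y) = star y * star x"
    and star_star: "star (star x) = x"
    and fin_dim: "\<exists>S. finite S \<and> span S = UNIV"

locale star_algebra_trace = fin_dim_star_algebra scale star
  for scale :: "complex \<Rightarrow> 'b::{ring, monoid_mult} \<Rightarrow> 'b" and star :: "'b \<Rightarrow> 'b" +
  fixes Tr :: "'b \<Rightarrow> complex"
  assumes trace_linear: "Vector_Spaces.linear scale (*) Tr"
    and trace_commute: "Tr (x * y) = Tr (y * x)"
    and trace_star: "Tr (star x) = cnj (Tr x)"

text \<open>
  Same recursion as \<open>pow_mat\<close>, which is only available over \<open>semiring_1\<close>, where \<open>0 \<noteq> 1\<close>.
\<close>
primrec matrix_power :: "'b::{ring, monoid_mult} mat \<Rightarrow> nat \<Rightarrow> 'b mat" where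
  "matrix_power A 0 = 1\<^sub>m (dim_row A)"
| "matrix_power A (Suc k) = matrix_power A k * A"

lemma matrix_power_eq_pow_mat: "matrix_power (A :: 'b::ring_1 mat) k = A ^\<^sub>m k"
  by (induction k) auto

definition matrix_trace :: "('b \<Rightarrow> complex) \<Rightarrow> 'b mat \<Rightarrow> complex" where
  "matrix_trace Tr W = (\<Sum>i<dim_row W. Tr (W $$ (i, i)))"

text \<open>
  A quiver is a \<open>fin_digraph\<close> (parallel arcs and loops allowed), with source map \<open>tail\<close> and target
  map \<open>head\<close>. The map \<open>vtx\<close> enumerates its vertices, identifying them with the row and column
  indices \<open>0, \<dots>, n - 1\<close>.
\<close>
definition sym_weight_matrix ::
  "('b \<Rightarrow> 'b) \<Rightarrow> ('v, 'e) pre_digraph \<Rightarrow> (nat \<Rightarrow> 'v) \<Rightarrow> ('e \<Rightarrow> 'b) \<Rightarrow> 'b::{ring, monoid_mult} mat" where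
  "sym_weight_matrix star Q vtx b =
     mat (card (verts Q)) (card (verts Q)) (\<lambda>(i, j).
       (\<Sum>e | e \<in> arcs Q \<and> tail Q e = vtx i \<and> head Q e = vtx j. b e) +
       (\<Sum>e | e \<in> arcs Q \<and> tail Q e = vtx j \<and> head Q e = vtx i. star (b e)))"

datatype 'e aug_arc = Orig 'e | Bar 'e

definition augmented :: "('v, 'e) pre_digraph \<Rightarrow> ('v, 'e aug_arc) pre_digraph" where
  "augmented Q =
     \<lparr> verts = verts Q,
       arcs = Orig ` arcs Q \<union> Bar ` {e \<in> arcs Q. tail Q e \<noteq> head Q e},
       tail = (\<lambda>a. case a of Orig e \<Rightarrow> tail Q e | Bar e \<Rightarrow> head Q e),
       head = (\<lambda>a. case a of Orig e \<Rightarrow> head Q e | Bar e \<Rightarrow> tail Q e) \<rparr>"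

fun sym_weight ::
  "('b \<Rightarrow> 'b) \<Rightarrow> ('v, 'e) pre_digraph \<Rightarrow> ('e \<Rightarrow> 'b) \<Rightarrow> 'e aug_arc \<Rightarrow> 'b::{ring, monoid_mult}" where
  "sym_weight star Q b (Orig e) = (if tail Q e = head Q e then b e + star (b e) else b e)"
| "sym_weight star Q b (Bar e) = star (b e)"

definition loops_at :: "('v, 'a) pre_digraph \<Rightarrow> 'v \<Rightarrow> 'a list set" where
  "loops_at G v = {p. pre_digraph.awalk G v p v \<and> p \<noteq> []}"

definition loops :: "('v, 'a) pre_digraph \<Rightarrow> 'a list set" where
  "loops G = (\<Union>v\<in>verts G. loops_at G v)"

fun rev_arc :: "('v, 'e) pre_digraph \<Rightarrow> 'e aug_arc \<Rightarrow> 'e aug_arc" where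
  "rev_arc Q (Orig e) = (if tail Q e = head Q e then Orig e else Bar e)"
| "rev_arc Q (Bar e) = Orig e"

definition rev_path :: "('v, 'e) pre_digraph \<Rightarrow> 'e aug_arc list \<Rightarrow> 'e aug_arc list" where
  "rev_path Q p = rev (map (rev_arc Q) p)"

definition sym_path_weight ::
  "('b \<Rightarrow> 'b) \<Rightarrow> ('b \<Rightarrow> complex) \<Rightarrow> ('v, 'e) pre_digraph \<Rightarrow> ('e \<Rightarrow> 'b::{ring, monoid_mult}) \<Rightarrow>
   'e aug_arc list \<Rightarrow> complex" where
  "sym_path_weight star Tr Q b p = Tr (prod_list (map (sym_weight star Q b) p))"

lemma augmented_simps [simp]:
  "verts (augmented Q) = verts Q"
  "arcs (augmented Q) = Orig ` arcs Q \<union> Bar ` {e \<in> arcs Q. tail Q e \<noteq> head Q e}"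
  "tail (augmented Q) (Orig e) = tail Q e" "tail (augmented Q) (Bar e) = head Q e"
  "head (augmented Q) (Orig e) = head Q e" "head (augmented Q) (Bar e) = tail Q e"
  by (simp_all add: augmented_def)

lemma fin_digraph_augmented:
  assumes "fin_digraph Q"
  shows "fin_digraph (augmented Q)"
proof -
  interpret fin_digraph Q by (fact assms)
  show ?thesis by unfold_locales auto
qed

lemma finite_loops_length:
  assumes "fin_digraph G"
  shows "finite {p \<in> loops G. length p = k}"
proof -
  interpret fin_digraph G by (fact assms)
  have "finite {p. set p \<subseteq> arcs G \<and> length p = k}"
    by (rule finite_lists_length_eq) simp
  then show ?thesis
    by (rule rev_finite_subset) (auto simp: loops_def loops_at_def awalk_def)
qed

lemma rev_path_in_loops_at:
  assumes "fin_digraph Q" and "p \<in> loops_at (augmented Q) v"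
  shows "rev_path Q p \<in> loops_at (augmented Q) v"
proof -
  interpret fin_digraph "augmented Q" using assms(1) by (rule fin_digraph_augmented)
  interpret Q: fin_digraph Q by (fact assms)
  have arc: "rev_arc Q a \<in> arcs (augmented Q) \<and>
      tail (augmented Q) (rev_arc Q a) = head (augmented Q) a \<and>
      head (augmented Q) (rev_arc Q a) = tail (augmented Q) a"
    if "a \<in> arcs (augmented Q)" for a
    using that by auto
  have "awalk w (rev_path Q p) u" if "awalk u p w" for u w
    using that
  proof (induction p arbitrary: u)
    case Nil
    then show ?case by (auto simp: rev_path_def awalk_Nil_iff)
  next
    case (Cons a p)
    then have a: "a \<in> arcs (augmented Q)" "tail (augmented Q) a = u"
      and p: "awalk (head (augmented Q) a) p w"
      by (auto simp: awalk_Cons_iff simp del: augmented_simps)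
    have "awalk (head (augmented Q) a) [rev_arc Q a] u"
      using arc[OF a(1)] a tail_in_verts[OF a(1)] head_in_verts[OF a(1)]
      by (simp add: awalk_def del: augmented_simps)
    with Cons.IH[OF p] show ?case
      by (auto simp: rev_path_def simp del: augmented_simps)
  qed
  with assms(2) show ?thesis
    by (auto simp: loops_at_def rev_path_def)
qed

end

theory Submission
  imports Defs
begin

text \<open>
  Splitting the weight of each self-loop as \<open>b e + star (b e)\<close> makes the symmetrised weight matrix
  of \<open>Q\<close> the ordinary weighted adjacency matrix of the augmented quiver
  (\<open>sym_weight_matrix_eq_arc_weight_matrix\<close>): an entry \<open>(i, j)\<close> sums the weights of all arcs from
  \<open>vtx i\<close> to \<open>vtx j\<close>. Expanding the matrix product by distributivity then shows that the entries of
  the \<open>k\<close>-th power sum the ordered weight products over all walks of length \<open>k\<close>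
  (\<open>matrix_power_arc_weight_matrix\<close>), so that the trace picks out the closed walks. As \<open>k > 0\<close>,
  a closed walk of length \<open>k\<close> is nonempty and determines its base point, hence is counted once.

  Reversing an arc stars its weight, and \<open>star\<close> reverses products, so reversing a closed
  walk stars its weight product and conjugates its trace. Reversal is an involution of the closed
  walks of length \<open>k\<close>; reindexing the sum by it shows that the sum is its own conjugate.
\<close>

section \<open>Powers of weighted adjacency matrices\<close>

definition arc_weight_matrix ::
  "('v, 'a) pre_digraph \<Rightarrow> nat \<Rightarrow> (nat \<Rightarrow> 'v) \<Rightarrow> ('a \<Rightarrow> 'b) \<Rightarrow> 'b::{ring, monoid_mult} mat" where
  "arc_weight_matrix G n vtx w =
     mat n n (\<lambda>(i, j). \<Sum>a | a \<in> arcs G \<and> tail G a = vtx i \<and> head G a = vtx j. w a)"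

lemma matrix_power_carrier:
  "A \<in> carrier_mat n n \<Longrightarrow> matrix_power A k \<in> carrier_mat n n"
  by (induction k) auto

context fin_digraph
begin

lemma finite_awalks_length: "finite {p. awalk u p v \<and> length p = k}"
proof -
  have "finite {p. set p \<subseteq> arcs G \<and> length p = k}"
    by (rule finite_lists_length_eq) simp
  then show ?thesis
    by (rule rev_finite_subset) (auto simp: awalk_def)
qed

lemma awalk_snoc_iff:
  "awalk u (p @ [a]) v \<longleftrightarrow> awalk u p (tail G a) \<and> a \<in> arcs G \<and> head G a = v"
  by (auto simp: awalk_simps)

text \<open>
  A walk of length \<open>Suc k\<close> is a walk of length \<open>k\<close> followed by one arc; the intermediate vertex
  is the summation index of the matrix product.
\<close>
lemma matrix_power_arc_weight_matrix:
  fixes w :: "'b \<Rightarrow> 'c::{ring, monoid_mult}"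
  assumes vtx: "bij_betw vtx {..<n} (verts G)"
    and "i < n" and "j < n"
  shows "matrix_power (arc_weight_matrix G n vtx w) k $$ (i, j) =
           (\<Sum>p | awalk (vtx i) p (vtx j) \<and> length p = k. prod_list (map w p))"
  using \<open>j < n\<close>
proof (induction k arbitrary: j)
  case 0
  have "vtx i = vtx j \<longleftrightarrow> i = j"
    using vtx \<open>i < n\<close> \<open>j < n\<close> by (auto simp: bij_betw_def inj_on_def)
  moreover have "vtx i \<in> verts G"
    using vtx \<open>i < n\<close> by (auto simp: bij_betw_def)
  ultimately have "{p. awalk (vtx i) p (vtx j) \<and> length p = 0} = (if i = j then {[]} else {})"
    by (auto simp: awalk_Nil_iff)
  with \<open>i < n\<close> 0 show ?case
    by (auto simp: arc_weight_matrix_def)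
next
  case (Suc k)
  let ?A = "arc_weight_matrix G n vtx w"
  let ?P = "\<lambda>m. {p. awalk (vtx i) p (vtx m) \<and> length p = k}"
  let ?E = "\<lambda>m. {a. a \<in> arcs G \<and> tail G a = vtx m \<and> head G a = vtx j}"
  have A: "?A \<in> carrier_mat n n"
    by (simp add: arc_weight_matrix_def)
  have "matrix_power ?A (Suc k) $$ (i, j) =
      (\<Sum>m<n. matrix_power ?A k $$ (i, m) * ?A $$ (m, j))"
    using A matrix_power_carrier[OF A, of k] \<open>i < n\<close> Suc.prems
    by (auto simp: scalar_prod_def lessThan_atLeast0 intro!: sum.cong)
  also have "\<dots> = (\<Sum>m<n. (\<Sum>p\<in>?P m. prod_list (map w p)) * (\<Sum>a\<in>?E m. w a))"
    using Suc by (intro sum.cong) (auto simp: arc_weight_matrix_def)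
  also have "\<dots> = (\<Sum>m<n. \<Sum>(p, a)\<in>?P m \<times> ?E m. prod_list (map w p) * w a)"
    by (simp add: sum_product sum.cartesian_product)
  also have "\<dots> = (\<Sum>(m, p, a)\<in>(SIGMA m:{..<n}. ?P m \<times> ?E m). prod_list (map w p) * w a)"
    by (rule sum.Sigma) (auto intro: finite_awalks_length)
  also have "\<dots> = (\<Sum>p | awalk (vtx i) p (vtx j) \<and> length p = Suc k. prod_list (map w p))"
  proof (rule sum.reindex_bij_witness
      [where j = "\<lambda>(m, p, a). p @ [a]"
         and i = "\<lambda>q. (inv_into {..<n} vtx (tail G (last q)), butlast q, last q)"])
    fix x assume "x \<in> (SIGMA m:{..<n}. ?P m \<times> ?E m)"
    then show "(case x of (m, p, a) \<Rightarrow> p @ [a]) \<in> {p. awalk (vtx i) p (vtx j) \<and> length p = Suc k}"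
      by (auto simp: awalk_snoc_iff simp del: awalk_append_iff)
  next
    fix q assume "q \<in> {p. awalk (vtx i) p (vtx j) \<and> length p = Suc k}"
    moreover from this obtain p a where q: "q = p @ [a]"
      by (cases q rule: rev_cases) auto
    ultimately have *: "awalk (vtx i) p (tail G a)" "a \<in> arcs G" "head G a = vtx j" "length p = k"
      by (auto simp: awalk_snoc_iff)
    from *(2) have "tail G a \<in> vtx ` {..<n}"
      using vtx by (auto simp: bij_betw_def)
    moreover from this have "inv_into {..<n} vtx (tail G a) \<in> {..<n}"
      by (rule inv_into_into)
    ultimately show "(inv_into {..<n} vtx (tail G (last q)), butlast q, last q)
        \<in> (SIGMA m:{..<n}. ?P m \<times> ?E m)"
      using * q by (simp add: f_inv_into_f)
    from q show "(case (inv_into {..<n} vtx (tail G (last q)), butlast q, last q) of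
        (m, p, a) \<Rightarrow> p @ [a]) = q"
      by simp
  qed (use vtx in \<open>auto simp: bij_betw_def\<close>)
  finally show ?case .
qed

text \<open>
  The empty walk is closed at every vertex; for \<open>k > 0\<close> the tail of the first arc tells the base
  point.
\<close>
lemma sum_loops_length:
  fixes f :: "'b list \<Rightarrow> 'c::comm_monoid_add"
  assumes "k > 0"
  shows "(\<Sum>p | p \<in> loops G \<and> length p = k. f p) =
           (\<Sum>v\<in>verts G. \<Sum>p | awalk v p v \<and> length p = k. f p)"
proof -
  have "{p. p \<in> loops G \<and> length p = k} = (\<Union>v\<in>verts G. {p. awalk v p v \<and> length p = k})"
    using assms by (auto simp: loops_def loops_at_def)
  moreover have "{p. awalk u p u \<and> length p = k} \<inter> {p. awalk v p v \<and> length p = k} = {}"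
    if "u \<noteq> v" for u v
  proof -
    have "u = v" if "awalk u p u" "awalk v p v" "length p = k" for p
      using that assms by (cases p) (auto simp: awalk_Cons_iff)
    with that show ?thesis by auto
  qed
  ultimately show ?thesis
    by (simp add: sum.UNION_disjoint finite_awalks_length)
qed

end

section \<open>The symmetrised weight matrix as an adjacency matrix\<close>

text \<open>
  Off the diagonal the arcs \<open>Orig e\<close> and \<open>Bar e\<close> contribute the two sums of an entry. On the
  diagonal every arc is a self-loop and occurs in both sums, which matches the weight
  \<open>b e + star (b e)\<close> of the single arc \<open>Orig e\<close>.
\<close>
lemma sum_sym_weight:
  assumes "fin_digraph Q"
  shows "(\<Sum>a | a \<in> arcs (augmented Q) \<and> tail (augmented Q) a = u \<and> head (augmented Q) a = v.
             sym_weight star Q b a) =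
           (\<Sum>e | e \<in> arcs Q \<and> tail Q e = u \<and> head Q e = v. b e) +
           (\<Sum>e | e \<in> arcs Q \<and> tail Q e = v \<and> head Q e = u. star (b e))"
proof -
  interpret fin_digraph Q by (fact assms)
  let ?E = "\<lambda>u v. {e. e \<in> arcs Q \<and> tail Q e = u \<and> head Q e = v}"
  let ?w = "sym_weight star Q b"
  have arcs: "{a. a \<in> arcs (augmented Q) \<and> tail (augmented Q) a = u \<and> head (augmented Q) a = v} =
      Orig ` ?E u v \<union> Bar ` (if u = v then {} else ?E v u)"
    by auto
  have "(\<Sum>a\<in>Orig ` ?E u v \<union> Bar ` (if u = v then {} else ?E v u). ?w a) =
      (\<Sum>a\<in>Orig ` ?E u v. ?w a) + (\<Sum>a\<in>Bar ` (if u = v then {} else ?E v u). ?w a)"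
    by (rule sum.union_disjoint) auto
  also have "\<dots> = (\<Sum>e\<in>?E u v. ?w (Orig e)) + (\<Sum>e\<in>(if u = v then {} else ?E v u). ?w (Bar e))"
    by (simp add: sum.reindex inj_on_def)
  also have "\<dots> = (\<Sum>e\<in>?E u v. b e) + (\<Sum>e\<in>?E v u. star (b e))"
    by (cases "u = v") (auto simp: sum.distrib intro!: sum.cong)
  finally show ?thesis
    by (simp only: arcs)
qed

lemma sym_weight_matrix_eq_arc_weight_matrix:
  assumes "fin_digraph Q"
  shows "sym_weight_matrix star Q vtx b =
           arc_weight_matrix (augmented Q) (card (verts Q)) vtx (sym_weight star Q b)"
  by (simp only: sym_weight_matrix_def arc_weight_matrix_def sum_sym_weight[OF assms])

section \<open>Reversal of paths\<close>

text \<open>Unitality is automatic for an involutive antihomomorphism: \<open>star 1\<close> is neutral for the products on the image of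
  \<open>star\<close>, which is everything.\<close>
lemma (in fin_dim_star_algebra) star_one: "star 1 = 1"
  by (metis mult_1_left mult_1_right star_mult star_star)

lemma (in fin_dim_star_algebra) star_prod_list:
  "star (prod_list xs) = prod_list (rev (map star xs))"
  by (induction xs) (simp_all add: star_one star_mult)

lemma (in fin_dim_star_algebra) sym_weight_rev_arc:
  "a \<in> arcs (augmented Q) \<Longrightarrow> sym_weight star Q b (rev_arc Q a) = star (sym_weight star Q b a)"
  by (auto simp: star_add star_star add.commute)

lemma (in star_algebra_trace) sym_path_weight_rev_path:
  assumes "set p \<subseteq> arcs (augmented Q)"
  shows "sym_path_weight star Tr Q b (rev_path Q p) = cnj (sym_path_weight star Tr Q b p)"
proof -
  have "map (sym_weight star Q b) (map (rev_arc Q) p) = map star (map (sym_weight star Q b) p)"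
    using assms by (auto simp: sym_weight_rev_arc simp del: augmented_simps)
  then have "prod_list (map (sym_weight star Q b) (rev_path Q p)) =
      star (prod_list (map (sym_weight star Q b) p))"
    by (simp only: rev_path_def star_prod_list rev_map[symmetric])
  then show ?thesis
    by (simp add: sym_path_weight_def trace_star)
qed

text \<open>
  The barred version of a self-loop would reverse to the unbarred one and not come back, but it is
  no arc of the augmented quiver.
\<close>
lemma rev_path_rev_path:
  assumes "set p \<subseteq> arcs (augmented Q)"
  shows "rev_path Q (rev_path Q p) = p"
proof -
  have "rev_arc Q (rev_arc Q a) = a" if "a \<in> arcs (augmented Q)" for a
    using that by auto
  with assms have "map (rev_arc Q \<circ> rev_arc Q) p = p"
    by (intro map_idI) (auto simp del: augmented_simps)
  then show ?thesis
    by (simp add: rev_path_def rev_map)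
qed

lemma length_rev_path: "length (rev_path Q p) = length p"
  by (simp add: rev_path_def)

lemma loops_subset_arcs: "p \<in> loops G \<Longrightarrow> set p \<subseteq> arcs G"
  by (auto simp: loops_def loops_at_def pre_digraph.awalk_def)

lemma rev_path_in_loops:
  "fin_digraph Q \<Longrightarrow> p \<in> loops (augmented Q) \<Longrightarrow> rev_path Q p \<in> loops (augmented Q)"
  by (auto simp: loops_def intro: rev_path_in_loops_at)

section \<open>The trace formula\<close>

lemma (in star_algebra_trace) Tr_sum: "Tr (sum f S) = (\<Sum>x\<in>S. Tr (f x))"
proof -
  interpret Vector_Spaces.linear scale "(*)" Tr by (fact trace_linear)
  show ?thesis by (rule sum)
qed

lemma (in star_algebra_trace) trace_power_sym_weight_matrix:
  assumes Q: "fin_digraph Q"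
    and vtx: "bij_betw vtx {..<card (verts Q)} (verts Q)"
    and k: "k > 0"
  shows "matrix_trace Tr (matrix_power (sym_weight_matrix star Q vtx b) k) =
           (\<Sum>p | p \<in> loops (augmented Q) \<and> length p = k. sym_path_weight star Tr Q b p)"
proof -
  interpret aug: fin_digraph "augmented Q"
    using Q by (rule fin_digraph_augmented)
  let ?n = "card (verts Q)"
  let ?W = "\<lambda>v. \<Sum>p | aug.awalk v p v \<and> length p = k. sym_path_weight star Tr Q b p"
  let ?A = "arc_weight_matrix (augmented Q) ?n vtx (sym_weight star Q b)"
  have A: "matrix_power ?A k \<in> carrier_mat ?n ?n"
    by (rule matrix_power_carrier) (simp add: arc_weight_matrix_def)
  have "matrix_trace Tr (matrix_power ?A k) = (\<Sum>i<?n. Tr (matrix_power ?A k $$ (i, i)))"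
    using A by (simp add: matrix_trace_def)
  also have "\<dots> = (\<Sum>i<?n. ?W (vtx i))"
    using vtx by (intro sum.cong)
      (simp_all add: aug.matrix_power_arc_weight_matrix Tr_sum sym_path_weight_def)
  also have "\<dots> = (\<Sum>v\<in>verts Q. ?W v)"
    using vtx by (rule sum.reindex_bij_betw)
  also have "\<dots> = (\<Sum>p | p \<in> loops (augmented Q) \<and> length p = k. sym_path_weight star Tr Q b p)"
    unfolding aug.sum_loops_length[OF k] by simp
  finally show ?thesis
    by (simp only: sym_weight_matrix_eq_arc_weight_matrix[OF Q])
qed

lemma (in star_algebra_trace) sum_sym_path_weight_real:
  assumes Q: "fin_digraph Q"
  shows "(\<Sum>p | p \<in> loops (augmented Q) \<and> length p = k. sym_path_weight star Tr Q b p) \<in> \<real>"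
    (is "sum ?w ?L \<in> \<real>")
proof -
  have "sum ?w ?L = (\<Sum>p\<in>?L. ?w (rev_path Q p))"
    by (rule sum.reindex_bij_witness[where i = "rev_path Q" and j = "rev_path Q"])
      (use Q in \<open>auto simp: rev_path_rev_path loops_subset_arcs rev_path_in_loops
         length_rev_path simp del: augmented_simps\<close>)
  also have "\<dots> = cnj (sum ?w ?L)"
    by (simp add: sym_path_weight_rev_path loops_subset_arcs del: augmented_simps)
  finally show ?thesis
    by (simp add: Reals_cnj_iff)
qed

theorem corollary3p6:
  fixes scale :: "complex \<Rightarrow> 'b::{ring, monoid_mult} \<Rightarrow> 'b"
    and star :: "'b \<Rightarrow> 'b"
    and Tr :: "'b \<Rightarrow> complex"
    and Q :: "('v, 'e) pre_digraph"
    and b :: "'e \<Rightarrow> 'b"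
    and vtx :: "nat \<Rightarrow> 'v"
    and k :: nat
  assumes "star_algebra_trace scale star Tr"
    and "fin_digraph Q"
    and "bij_betw vtx {..<card (verts Q)} (verts Q)"
    and "k > 0"
  shows "matrix_trace Tr (matrix_power (sym_weight_matrix star Q vtx b) k) =
           (\<Sum>p | p \<in> loops (augmented Q) \<and> length p = k. sym_path_weight star Tr Q b p)
       \<and> (\<forall>v \<in> verts Q. \<forall>p \<in> loops_at (augmented Q) v.
            sym_path_weight star Tr Q b (rev_path Q p) = cnj (sym_path_weight star Tr Q b p))
       \<and> matrix_trace Tr (matrix_power (sym_weight_matrix star Q vtx b) k) \<in> \<real>"
proof (intro conjI ballI)
  interpret star_algebra_trace scale star Tr by (fact assms(1))
  show formula: "matrix_trace Tr (matrix_power (sym_weight_matrix star Q vtx b) k) =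
      (\<Sum>p | p \<in> loops (augmented Q) \<and> length p = k. sym_path_weight star Tr Q b p)"
    using assms(2-4) by (rule trace_power_sym_weight_matrix)
  show "matrix_trace Tr (matrix_power (sym_weight_matrix star Q vtx b) k) \<in> \<real>"
    unfolding formula using assms(2) by (rule sum_sym_path_weight_real)
  fix v p assume "v \<in> verts Q" "p \<in> loops_at (augmented Q) v"
  then have "p \<in> loops (augmented Q)"
    by (auto simp: loops_def)
  then show "sym_path_weight star Tr Q b (rev_path Q p) = cnj (sym_path_weight star Tr Q b p)"
    by (intro sym_path_weight_rev_path loops_subset_arcs)
qed

end
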